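(* For every well-formed term $\varphi$: $\emptyset\vdash\varphi$ is derivable in OGA if and only if $\varphi$ is super-true.
   Context: **Syntax.** Terms: $t::=v_i\mid\bot\mid\mathbf 0\mid\mathbf S t\mid t=t\mid\neg t\mid t\lor t\mid\lambda t\mid t\cdot t\mid\mathcal R\mid\mathcal A$ ($v_i$, $i\in\mathbb N$, de Bruijn variables; $\lambda$ is the only binder; application associates to the left). A term is well-formed (wf) if generated by this grammar. $\bot$ is a divergent constant, $\mathcal R$ the primitive recursor, $\mathcal A$ the universal quantifier. Abbreviations: $t\,\mathsf N$ is $t=t$; $t\,\mathsf B$ is $t\lor\neg t$; $t\ne u$ is $\neg(t=u)$; $t\land u$ is $\neg(\neg t\lor\neg u)$; $t\to u$ is $\neg t\lor u$; $\underline n=\mathbf S^n\mathbf 0$. $\uparrow$ shifts all free indices up by one; $b[t]$ is the $\beta$-instance substituting $t$ for the outermost bound variable of $b$; $[v\mapsto s]$ is capture-avoiding substitution for a free variable; $\mathrm{fv}$ is the set of free variables. **Head steps** $\triangleright$: $(\lambda b)\cdot t\triangleright b[t]$; $\mathcal R\cdot g\cdot h\cdot\mathbf 0\triangleright g$; $\mathcal R\cdot g\cdot h\cdot(\mathbf S\underline n)\triangleright h\cdot\underline n\cdot(\mathcal R\cdot g\cdot h\cdot\underline n)$; if $t\triangleright t'$ then $t\cdot u\triangleright t'\cdot u$. **Rules.** Judgments are $\Gamma\vdash c$, $\Gamma$ a finite set of wf terms, $c$ a wf term (all terms in rules are wf). A proof is a finite list of judgments each following from earlier entries by one rule; $\Gamma\vdash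 c$ is derivable if it occurs in a proof. Rules ("$\Rightarrow$" from premises to conclusion, "$\Leftrightarrow$" both directions; $\Gamma$ is the context of a judgment when none is shown): $\Gamma,c\vdash c$; $\Gamma\vdash c\Rightarrow\Gamma,a\vdash c$; $\Gamma\vdash a$ and $\Gamma,a\vdash c\Rightarrow\Gamma\vdash c$; $\Gamma\vdash c\Rightarrow[v\mapsto s]\Gamma\vdash[v\mapsto s]c$; $\vdash a\Leftrightarrow\ \vdash a=\underline1$; $\vdash\neg a\Leftrightarrow\ \vdash a=\underline0$; $\vdash\neg a,\ \vdash a\Rightarrow\ \vdash c$; $\vdash a\Leftrightarrow\ \vdash\neg\neg a$; $\vdash a\Rightarrow\ \vdash a\lor b$; $\vdash b\Rightarrow\ \vdash a\lor b$; $\vdash\neg a,\ \vdash\neg b\Rightarrow\ \vdash\neg(a\lor b)$; $\vdash a\lor b,\ \Gamma,a\vdash c,\ \Gamma,b\vdash c\Rightarrow\ \vdash c$; $\vdash\neg(a\lor b)\Rightarrow\ \vdash\neg a$; $\vdash\neg(a\lor b)\Rightarrow\ \vdash\neg b$; $\vdash a\,\mathsf N\Leftrightarrow\ \vdash a=a$; $\vdash a=b\Rightarrow\ \vdash b=a$; $\vdash a=b,\ \vdash[v\mapsto a]p\Rightarrow\ \vdash[v\mapsto b]p$; $\vdash a\ne b\Rightarrow\ \vdash b\ne a$; $\vdash a\,\mathsf N,\ \vdash b\,\mathsf N\Rightarrow\ \vdash(a=b)\,\mathsf B$; $\vdash(a=b)\,\mathsf B\Rightarrow\ \vdash(a\,\mathsf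 N)\land(b\,\mathsf N)$; $\vdash\mathbf 0\,\mathsf N$; $\vdash a\,\mathsf N\Leftrightarrow\ \vdash(\mathbf S a)\,\mathsf N$; $\vdash a\,\mathsf N\Rightarrow\ \vdash\mathbf S a\ne\mathbf 0$; $\vdash a\ne b\Leftrightarrow\ \vdash\mathbf S a\ne\mathbf S b$; $\vdash\mathbf S a=\mathbf S b\Rightarrow\ \vdash a=b$; $\vdash\bot\,\mathsf N\Rightarrow\ \vdash p$; induction: $\vdash[v_i\mapsto\mathbf 0]c$, $\ v_i\,\mathsf N,c,\Gamma\vdash[v_i\mapsto\mathbf S v_i]c$, $\ \vdash a\,\mathsf N\Rightarrow\ \vdash[v_i\mapsto a]c$ if $v_i\notin\mathrm{fv}(\Gamma)$; conversion, for $c\triangleright c'$: $\vdash c'\Rightarrow\ \vdash c$; $\vdash c\Rightarrow\ \vdash c'$; $\vdash\neg c\Rightarrow\ \vdash\neg c'$; $\vdash c'\,\mathsf N\Rightarrow\ \vdash c=c'$; $\vdash m\,\mathsf N,\ \vdash(h\cdot m\cdot(\mathcal R\cdot g\cdot h\cdot m))\,\mathsf N\Rightarrow\ \vdash\mathcal R\cdot g\cdot h\cdot(\mathbf S m)=h\cdot m\cdot(\mathcal R\cdot g\cdot h\cdot m)$; $v_0\,\mathsf N,\uparrow\Gamma\vdash\uparrow f\cdot v_0\Rightarrow\Gamma\vdash\mathcal A\cdot f$; $\vdash\mathcal A\cdot f,\ \vdash a\,\mathsf N\Rightarrow\ \vdash f\cdot a$; $\vdash\neg(f\cdot a),\ \vdash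 a\,\mathsf N\Rightarrow\ \vdash\neg(\mathcal A\cdot f)$; $\Gamma\vdash\neg(\mathcal A\cdot f)$ and $v_0\,\mathsf N,\neg(\uparrow f\cdot v_0),\uparrow\Gamma\vdash\uparrow c\Rightarrow\Gamma\vdash c$. These are the rules of RGA. OGA has these and the rule ATI: $\Gamma\vdash\mathcal A\cdot(\lambda((\uparrow u\cdot v_0)\,\mathsf B))\Rightarrow\Gamma\vdash(\mathcal A\cdot u)\,\mathsf B$. Below $\vdash$ is OGA-derivability. **Fafi values.** A universal $\mathcal A\cdot u$ is certified if $\emptyset\vdash\mathcal A\cdot(\lambda((\uparrow u\cdot v_0)\,\mathsf B))$. For each certified $\mathcal A\cdot u$ there is an atom $x_{\mathcal A\cdot u}$. Values are elements of the free Boolean algebra on these atoms, with constants $\top$ (true) and $\mathsf F$ (false). Evaluation $\varphi\rightsquigarrow p$ ("$p$ is a value of $\varphi$") is the least relation between terms and values with: $\varphi\rightsquigarrow\top$ if $\emptyset\vdash\varphi$; $\varphi\rightsquigarrow\mathsf F$ if $\emptyset\vdash\neg\varphi$; $\varphi\rightsquigarrow p$ implies $\neg\varphi\rightsquigarrow\neg p$; $\varphi\rightsquigarrow p$, $\psi\rightsquigarrow q$ imply $\varphi\lor\psi\rightsquigarrow p\lor q$; $\mathcal A\cdot u\rightsquigarrow x_{\mathcal A\cdot u}$ if $\mathcal A\cdot u$ is certified. **Super-truth.** A valuation $w$ assigns a truth value to every atom (extended homomorphically to values). A finite set $\Delta$ of terms is honest for $w$ if each member is either a certified $\mathcal A\cdot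 u$ with $w(x_{\mathcal A\cdot u})$ true, or $\neg(\mathcal A\cdot u)$ with $\mathcal A\cdot u$ certified and $w(x_{\mathcal A\cdot u})$ false. $w$ is admissible if for no $\Delta$ honest for $w$ is there a term $c$ with $\Delta\vdash c$ and $\Delta\vdash\neg c$. $\varphi$ is super-true if it has a value $p$ such that $w(p)$ is true for every admissible $w$. *)

theory Defs
  imports Main "HOL-Library.FSet"
begin

section \<open>Syntax\<close>

text \<open>The datatype is the grammar, so its elements are exactly the well-formed terms.\<close>

datatype tm =
    Var nat
  | Bot
  | Zero
  | Succ tm
  | Eq tm tm  (infix "\<^bold>=" 60)
  | Neg tm  ("\<^bold>\<not> _" [58] 58)
  | Or tm tm  (infixr "\<^bold>\<or>" 55)
  | Lam tm
  | App tm tm  (infixl "\<cdot>" 100)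
  | Rec
  | All

abbreviation And :: "tm \<Rightarrow> tm \<Rightarrow> tm"  (infixr "\<^bold>\<and>" 56) where
  "t \<^bold>\<and> u \<equiv> \<^bold>\<not> (\<^bold>\<not> t \<^bold>\<or> \<^bold>\<not> u)"

abbreviation Neq :: "tm \<Rightarrow> tm \<Rightarrow> tm"  (infix "\<^bold>\<noteq>" 60) where
  "t \<^bold>\<noteq> u \<equiv> \<^bold>\<not> (t \<^bold>= u)"

abbreviation isN :: "tm \<Rightarrow> tm" where
  "isN t \<equiv> t \<^bold>= t"

abbreviation isB :: "tm \<Rightarrow> tm" where
  "isB t \<equiv> t \<^bold>\<or> \<^bold>\<not> t"

definition num :: "nat \<Rightarrow> tm" where
  "num n = (Succ ^^ n) Zero"

fun fv :: "tm \<Rightarrow> nat set" where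
  "fv (Var i) = {i}"
| "fv Bot = {}"
| "fv Zero = {}"
| "fv (Succ t) = fv t"
| "fv (t \<^bold>= u) = fv t \<union> fv u"
| "fv (\<^bold>\<not> t) = fv t"
| "fv (t \<^bold>\<or> u) = fv t \<union> fv u"
| "fv (Lam b) = {i. Suc i \<in> fv b}"
| "fv (t \<cdot> u) = fv t \<union> fv u"
| "fv Rec = {}"
| "fv All = {}"

text \<open>The parameter \<open>k\<close> of \<open>shift\<close> and \<open>inst\<close> is the number of binders already passed.\<close>

fun shift :: "nat \<Rightarrow> tm \<Rightarrow> tm" where
  "shift k (Var i) = Var (if i < k then i else Suc i)"
| "shift k Bot = Bot"
| "shift k Zero = Zero"
| "shift k (Succ t) = Succ (shift k t)"
| "shift k (t \<^bold>= u) = (shift k t \<^bold>= shift k u)"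
| "shift k (\<^bold>\<not> t) = \<^bold>\<not> shift k t"
| "shift k (t \<^bold>\<or> u) = (shift k t \<^bold>\<or> shift k u)"
| "shift k (Lam b) = Lam (shift (Suc k) b)"
| "shift k (t \<cdot> u) = shift k t \<cdot> shift k u"
| "shift k Rec = Rec"
| "shift k All = All"

abbreviation up :: "tm \<Rightarrow> tm"  ("\<up> _" [101] 101) where
  "\<up> t \<equiv> shift 0 t"

text \<open>\<open>subst i s t\<close> is \<open>[v\<^sub>i \<mapsto> s]t\<close>: no index is lowered, in contrast to \<open>inst\<close>, where the
  binder of the replaced variable disappears.\<close>

fun subst :: "nat \<Rightarrow> tm \<Rightarrow> tm \<Rightarrow> tm" where
  "subst i s (Var j) = (if j = i then s else Var j)"
| "subst i s Bot = Bot"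
| "subst i s Zero = Zero"
| "subst i s (Succ t) = Succ (subst i s t)"
| "subst i s (t \<^bold>= u) = (subst i s t \<^bold>= subst i s u)"
| "subst i s (\<^bold>\<not> t) = \<^bold>\<not> subst i s t"
| "subst i s (t \<^bold>\<or> u) = (subst i s t \<^bold>\<or> subst i s u)"
| "subst i s (Lam b) = Lam (subst (Suc i) (\<up> s) b)"
| "subst i s (t \<cdot> u) = subst i s t \<cdot> subst i s u"
| "subst i s Rec = Rec"
| "subst i s All = All"

fun inst :: "nat \<Rightarrow> tm \<Rightarrow> tm \<Rightarrow> tm" where
  "inst k s (Var j) = (if j < k then Var j else if j = k then s else Var (j - 1))"
| "inst k s Bot = Bot"
| "inst k s Zero = Zero"
| "inst k s (Succ t) = Succ (inst k s t)"
| "inst k s (t \<^bold>= u) = (inst k s t \<^bold>= inst k s u)"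
| "inst k s (\<^bold>\<not> t) = \<^bold>\<not> inst k s t"
| "inst k s (t \<^bold>\<or> u) = (inst k s t \<^bold>\<or> inst k s u)"
| "inst k s (Lam b) = Lam (inst (Suc k) (\<up> s) b)"
| "inst k s (t \<cdot> u) = inst k s t \<cdot> inst k s u"
| "inst k s Rec = Rec"
| "inst k s All = All"

inductive head_step :: "tm \<Rightarrow> tm \<Rightarrow> bool"  (infix "\<triangleright>" 50) where
  beta: "Lam b \<cdot> t \<triangleright> inst 0 t b"
| rec_zero: "Rec \<cdot> g \<cdot> h \<cdot> Zero \<triangleright> g"
| rec_succ: "Rec \<cdot> g \<cdot> h \<cdot> Succ (num n) \<triangleright> h \<cdot> num n \<cdot> (Rec \<cdot> g \<cdot> h \<cdot> num n)"
| app: "t \<triangleright> t' \<Longrightarrow> t \<cdot> u \<triangleright> t' \<cdot> u"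


section \<open>Derivability\<close>

datatype sequent = Sequent "tm fset" tm  (infix "\<turnstile>" 50)

text \<open>\<open>rga_rule ps j\<close>: the list \<open>ps\<close> of premises and the conclusion \<open>j\<close> form an instance of a rule.
  A rule that holds in both directions appears as two rules.\<close>

inductive rga_rule :: "sequent list \<Rightarrow> sequent \<Rightarrow> bool" where
  assm: "rga_rule [] (finsert c \<Gamma> \<turnstile> c)"
| weaken: "rga_rule [\<Gamma> \<turnstile> c] (finsert a \<Gamma> \<turnstile> c)"
| cut: "rga_rule [\<Gamma> \<turnstile> a, finsert a \<Gamma> \<turnstile> c] (\<Gamma> \<turnstile> c)"
| substitution: "rga_rule [\<Gamma> \<turnstile> c] (subst i s |`| \<Gamma> \<turnstile> subst i s c)"

| eq_one_I: "rga_rule [\<Gamma> \<turnstile> a] (\<Gamma> \<turnstile> a \<^bold>= num 1)"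
| eq_one_D: "rga_rule [\<Gamma> \<turnstile> a \<^bold>= num 1] (\<Gamma> \<turnstile> a)"
| eq_zero_I: "rga_rule [\<Gamma> \<turnstile> \<^bold>\<not> a] (\<Gamma> \<turnstile> a \<^bold>= num 0)"
| eq_zero_D: "rga_rule [\<Gamma> \<turnstile> a \<^bold>= num 0] (\<Gamma> \<turnstile> \<^bold>\<not> a)"

| explosion: "rga_rule [\<Gamma> \<turnstile> \<^bold>\<not> a, \<Gamma> \<turnstile> a] (\<Gamma> \<turnstile> c)"
| notnot_I: "rga_rule [\<Gamma> \<turnstile> a] (\<Gamma> \<turnstile> \<^bold>\<not> \<^bold>\<not> a)"
| notnot_D: "rga_rule [\<Gamma> \<turnstile> \<^bold>\<not> \<^bold>\<not> a] (\<Gamma> \<turnstile> a)"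

| or_I1: "rga_rule [\<Gamma> \<turnstile> a] (\<Gamma> \<turnstile> a \<^bold>\<or> b)"
| or_I2: "rga_rule [\<Gamma> \<turnstile> b] (\<Gamma> \<turnstile> a \<^bold>\<or> b)"
| not_or_I: "rga_rule [\<Gamma> \<turnstile> \<^bold>\<not> a, \<Gamma> \<turnstile> \<^bold>\<not> b] (\<Gamma> \<turnstile> \<^bold>\<not> (a \<^bold>\<or> b))"
| or_E: "rga_rule [\<Gamma> \<turnstile> a \<^bold>\<or> b, finsert a \<Gamma> \<turnstile> c, finsert b \<Gamma> \<turnstile> c] (\<Gamma> \<turnstile> c)"
| not_or_D1: "rga_rule [\<Gamma> \<turnstile> \<^bold>\<not> (a \<^bold>\<or> b)] (\<Gamma> \<turnstile> \<^bold>\<not> a)"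
| not_or_D2: "rga_rule [\<Gamma> \<turnstile> \<^bold>\<not> (a \<^bold>\<or> b)] (\<Gamma> \<turnstile> \<^bold>\<not> b)"

| isN_D: "rga_rule [\<Gamma> \<turnstile> isN a] (\<Gamma> \<turnstile> a \<^bold>= a)"
| isN_I: "rga_rule [\<Gamma> \<turnstile> a \<^bold>= a] (\<Gamma> \<turnstile> isN a)"
| eq_sym: "rga_rule [\<Gamma> \<turnstile> a \<^bold>= b] (\<Gamma> \<turnstile> b \<^bold>= a)"
| eq_subst: "rga_rule [\<Gamma> \<turnstile> a \<^bold>= b, \<Gamma> \<turnstile> subst i a p] (\<Gamma> \<turnstile> subst i b p)"
| neq_sym: "rga_rule [\<Gamma> \<turnstile> a \<^bold>\<noteq> b] (\<Gamma> \<turnstile> b \<^bold>\<noteq> a)"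
| eq_isB_I: "rga_rule [\<Gamma> \<turnstile> isN a, \<Gamma> \<turnstile> isN b] (\<Gamma> \<turnstile> isB (a \<^bold>= b))"
| eq_isB_D: "rga_rule [\<Gamma> \<turnstile> isB (a \<^bold>= b)] (\<Gamma> \<turnstile> isN a \<^bold>\<and> isN b)"

| zero_isN: "rga_rule [] (\<Gamma> \<turnstile> isN Zero)"
| succ_isN_I: "rga_rule [\<Gamma> \<turnstile> isN a] (\<Gamma> \<turnstile> isN (Succ a))"
| succ_isN_D: "rga_rule [\<Gamma> \<turnstile> isN (Succ a)] (\<Gamma> \<turnstile> isN a)"
| succ_neq_zero: "rga_rule [\<Gamma> \<turnstile> isN a] (\<Gamma> \<turnstile> Succ a \<^bold>\<noteq> Zero)"
| succ_neq_I: "rga_rule [\<Gamma> \<turnstile> a \<^bold>\<noteq> b] (\<Gamma> \<turnstile> Succ a \<^bold>\<noteq> Succ b)"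
| succ_neq_D: "rga_rule [\<Gamma> \<turnstile> Succ a \<^bold>\<noteq> Succ b] (\<Gamma> \<turnstile> a \<^bold>\<noteq> b)"
| succ_inject: "rga_rule [\<Gamma> \<turnstile> Succ a \<^bold>= Succ b] (\<Gamma> \<turnstile> a \<^bold>= b)"
| bot_E: "rga_rule [\<Gamma> \<turnstile> isN Bot] (\<Gamma> \<turnstile> p)"

| induction: "(\<And>\<gamma>. \<gamma> |\<in>| \<Gamma> \<Longrightarrow> i \<notin> fv \<gamma>) \<Longrightarrow>
    rga_rule
      [\<Gamma> \<turnstile> subst i Zero c,
       finsert (isN (Var i)) (finsert c \<Gamma>) \<turnstile> subst i (Succ (Var i)) c,
       \<Gamma> \<turnstile> isN a]
      (\<Gamma> \<turnstile> subst i a c)"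

| conv_expand: "c \<triangleright> c' \<Longrightarrow> rga_rule [\<Gamma> \<turnstile> c'] (\<Gamma> \<turnstile> c)"
| conv_reduce: "c \<triangleright> c' \<Longrightarrow> rga_rule [\<Gamma> \<turnstile> c] (\<Gamma> \<turnstile> c')"
| conv_not: "c \<triangleright> c' \<Longrightarrow> rga_rule [\<Gamma> \<turnstile> \<^bold>\<not> c] (\<Gamma> \<turnstile> \<^bold>\<not> c')"
| conv_eq: "c \<triangleright> c' \<Longrightarrow> rga_rule [\<Gamma> \<turnstile> isN c'] (\<Gamma> \<turnstile> c \<^bold>= c')"

| rec_step: "rga_rule [\<Gamma> \<turnstile> isN m, \<Gamma> \<turnstile> isN (h \<cdot> m \<cdot> (Rec \<cdot> g \<cdot> h \<cdot> m))]
    (\<Gamma> \<turnstile> Rec \<cdot> g \<cdot> h \<cdot> Succ m \<^bold>= h \<cdot> m \<cdot> (Rec \<cdot> g \<cdot> h \<cdot> m))"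

| all_I: "rga_rule [finsert (isN (Var 0)) (shift 0 |`| \<Gamma>) \<turnstile> \<up> f \<cdot> Var 0] (\<Gamma> \<turnstile> All \<cdot> f)"
| all_D: "rga_rule [\<Gamma> \<turnstile> All \<cdot> f, \<Gamma> \<turnstile> isN a] (\<Gamma> \<turnstile> f \<cdot> a)"
| not_all_I: "rga_rule [\<Gamma> \<turnstile> \<^bold>\<not> (f \<cdot> a), \<Gamma> \<turnstile> isN a] (\<Gamma> \<turnstile> \<^bold>\<not> (All \<cdot> f))"
| not_all_E: "rga_rule
    [\<Gamma> \<turnstile> \<^bold>\<not> (All \<cdot> f),
     finsert (isN (Var 0)) (finsert (\<^bold>\<not> (\<up> f \<cdot> Var 0)) (shift 0 |`| \<Gamma>)) \<turnstile> \<up> c]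
    (\<Gamma> \<turnstile> c)"

inductive oga_rule :: "sequent list \<Rightarrow> sequent \<Rightarrow> bool" where
  rga: "rga_rule ps j \<Longrightarrow> oga_rule ps j"
| ati: "oga_rule [\<Gamma> \<turnstile> All \<cdot> Lam (isB (\<up> u \<cdot> Var 0))] (\<Gamma> \<turnstile> isB (All \<cdot> u))"

definition is_proof :: "(sequent list \<Rightarrow> sequent \<Rightarrow> bool) \<Rightarrow> sequent list \<Rightarrow> bool" where
  "is_proof rule js \<longleftrightarrow>
    (\<forall>i < length js. \<exists>ps. rule ps (js ! i) \<and> set ps \<subseteq> set (take i js))"

definition derivable :: "(sequent list \<Rightarrow> sequent \<Rightarrow> bool) \<Rightarrow> sequent \<Rightarrow> bool" where
  "derivable rule j \<longleftrightarrow> (\<exists>js. is_proof rule js \<and> j \<in> set js)"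

abbreviation oga :: "tm fset \<Rightarrow> tm \<Rightarrow> bool"  (infix "\<turnstile>\<^sub>O" 50) where
  "\<Gamma> \<turnstile>\<^sub>O c \<equiv> derivable oga_rule (\<Gamma> \<turnstile> c)"

lemma is_proof_append:
  assumes "is_proof rule js" "is_proof rule ks"
  shows "is_proof rule (js @ ks)"
  unfolding is_proof_def
proof (intro allI impI)
  fix i assume i: "i < length (js @ ks)"
  show "\<exists>ps. rule ps ((js @ ks) ! i) \<and> set ps \<subseteq> set (take i (js @ ks))"
  proof (cases "i < length js")
    case True
    then show ?thesis using assms(1) by (auto simp: is_proof_def nth_append)
  next
    case False
    then have "i - length js < length ks" using i by auto
    then obtain ps where "rule ps (ks ! (i - length js))" "set ps \<subseteq> set (take (i - length js) ks)"
      using assms(2) unfolding is_proof_def by blast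
    then show ?thesis using False by (auto simp: nth_append)
  qed
qed

lemma is_proof_snoc:
  assumes "is_proof rule js" "rule ps j" "set ps \<subseteq> set js"
  shows "is_proof rule (js @ [j])"
  using assms unfolding is_proof_def by (auto simp: nth_append less_Suc_eq)

lemma derivable_rule:
  assumes "rule ps j" and "\<And>p. p \<in> set ps \<Longrightarrow> derivable rule p"
  shows "derivable rule j"
proof -
  have "\<exists>js. is_proof rule js \<and> set ps \<subseteq> set js"
    using assms(2)
  proof (induction ps)
    case Nil
    have "is_proof rule []" by (simp add: is_proof_def)
    then show ?case by auto
  next
    case (Cons p ps)
    then obtain js where "is_proof rule js" "set ps \<subseteq> set js" by auto
    moreover obtain ks where "is_proof rule ks" "p \<in> set ks"
      using Cons.prems by (auto simp: derivable_def)
    ultimately show ?case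
      by (intro exI[of _ "js @ ks"]) (auto intro: is_proof_append)
  qed
  then obtain js where "is_proof rule js" "set ps \<subseteq> set js" by auto
  then have "is_proof rule (js @ [j])" using assms(1) by (blast intro: is_proof_snoc)
  then show ?thesis unfolding derivable_def by (intro exI[of _ "js @ [j]"]) simp
qed


section \<open>Free Boolean algebras\<close>

text \<open>The free Boolean algebra on \<open>'a\<close>: Boolean expressions modulo the congruence generated by
  the Boolean algebra axioms.\<close>

datatype 'a bexp =
    BGen 'a
  | BTop
  | BBot
  | BNot "'a bexp"
  | BAnd "'a bexp" "'a bexp"
  | BOr "'a bexp" "'a bexp"

inductive beq :: "'a bexp \<Rightarrow> 'a bexp \<Rightarrow> bool" where
  refl: "beq a a"
| sym: "beq a b \<Longrightarrow> beq b a"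
| trans: "beq a b \<Longrightarrow> beq b c \<Longrightarrow> beq a c"
| cong_not: "beq a a' \<Longrightarrow> beq (BNot a) (BNot a')"
| cong_and: "beq a a' \<Longrightarrow> beq b b' \<Longrightarrow> beq (BAnd a b) (BAnd a' b')"
| cong_or: "beq a a' \<Longrightarrow> beq b b' \<Longrightarrow> beq (BOr a b) (BOr a' b')"
| and_comm: "beq (BAnd a b) (BAnd b a)"
| or_comm: "beq (BOr a b) (BOr b a)"
| and_assoc: "beq (BAnd (BAnd a b) c) (BAnd a (BAnd b c))"
| or_assoc: "beq (BOr (BOr a b) c) (BOr a (BOr b c))"
| and_absorb: "beq (BAnd a (BOr a b)) a"
| or_absorb: "beq (BOr a (BAnd a b)) a"
| or_distrib: "beq (BOr a (BAnd b c)) (BAnd (BOr a b) (BOr a c))"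
| and_top: "beq (BAnd a BTop) a"
| or_bot: "beq (BOr a BBot) a"
| and_not: "beq (BAnd a (BNot a)) BBot"
| or_not: "beq (BOr a (BNot a)) BTop"

quotient_type 'a fba = "'a bexp" / beq
  by (intro equivpI reflpI sympI transpI) (fact beq.refl beq.sym beq.trans)+

lift_definition gen :: "'a \<Rightarrow> 'a fba" is BGen .

instantiation fba :: (type) boolean_algebra
begin

lift_definition top_fba :: "'a fba" is BTop .
lift_definition bot_fba :: "'a fba" is BBot .
lift_definition uminus_fba :: "'a fba \<Rightarrow> 'a fba" is BNot by (fact beq.cong_not)
lift_definition inf_fba :: "'a fba \<Rightarrow> 'a fba \<Rightarrow> 'a fba" is BAnd by (fact beq.cong_and)
lift_definition sup_fba :: "'a fba \<Rightarrow> 'a fba \<Rightarrow> 'a fba" is BOr by (fact beq.cong_or)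

definition minus_fba :: "'a fba \<Rightarrow> 'a fba \<Rightarrow> 'a fba" where
  "minus_fba a b = inf a (- b)"

definition less_eq_fba :: "'a fba \<Rightarrow> 'a fba \<Rightarrow> bool" where
  "less_eq_fba a b \<longleftrightarrow> inf a b = a"

definition less_fba :: "'a fba \<Rightarrow> 'a fba \<Rightarrow> bool" where
  "less_fba a b \<longleftrightarrow> a \<le> b \<and> \<not> b \<le> (a :: 'a fba)"

instance
proof -
  have inf_comm: "inf a b = inf b a" for a b :: "'a fba"
    by transfer (fact beq.and_comm)
  have sup_comm: "sup a b = sup b a" for a b :: "'a fba"
    by transfer (fact beq.or_comm)
  have inf_assoc: "inf (inf a b) c = inf a (inf b c)" for a b c :: "'a fba"
    by transfer (fact beq.and_assoc)
  have sup_assoc: "sup (sup a b) c = sup a (sup b c)" for a b c :: "'a fba"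
    by transfer (fact beq.or_assoc)
  have inf_absorb: "inf a (sup a b) = a" for a b :: "'a fba"
    by transfer (fact beq.and_absorb)
  have sup_absorb: "sup a (inf a b) = a" for a b :: "'a fba"
    by transfer (fact beq.or_absorb)
  have distrib: "sup a (inf b c) = inf (sup a b) (sup a c)" for a b c :: "'a fba"
    by transfer (fact beq.or_distrib)
  have inf_top: "inf a top = a" for a :: "'a fba"
    by transfer (fact beq.and_top)
  have sup_bot: "sup a bot = a" for a :: "'a fba"
    by transfer (fact beq.or_bot)
  have inf_not: "inf a (- a) = bot" for a :: "'a fba"
    by transfer (fact beq.and_not)
  have sup_not: "sup a (- a) = top" for a :: "'a fba"
    by transfer (fact beq.or_not)
  have inf_idem: "inf a a = a" for a :: "'a fba"
    by (metis inf_absorb sup_absorb)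
  have le_sup: "a \<le> b \<longleftrightarrow> sup a b = b" for a b :: "'a fba"
    unfolding less_eq_fba_def by (metis inf_absorb sup_absorb inf_comm sup_comm)
  show "OFCLASS('a fba, boolean_algebra_class)"
  proof
    fix x y z :: "'a fba"
    show "x < y \<longleftrightarrow> x \<le> y \<and> \<not> y \<le> x" by (fact less_fba_def)
    show "x \<le> x" by (simp add: less_eq_fba_def inf_idem)
    show "x \<le> z" if "x \<le> y" "y \<le> z"
      using that unfolding less_eq_fba_def by (metis inf_assoc)
    show "x = y" if "x \<le> y" "y \<le> x"
      using that unfolding less_eq_fba_def by (metis inf_comm)
    show "inf x y \<le> x"
      unfolding less_eq_fba_def by (metis inf_assoc inf_comm inf_idem)
    show "inf x y \<le> y"
      unfolding less_eq_fba_def by (metis inf_assoc inf_idem)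
    show "x \<le> inf y z" if "x \<le> y" "x \<le> z"
      using that unfolding less_eq_fba_def by (metis inf_assoc)
    show "x \<le> sup x y"
      unfolding less_eq_fba_def by (fact inf_absorb)
    show "y \<le> sup x y"
      unfolding less_eq_fba_def by (metis inf_absorb sup_comm)
    show "sup y z \<le> x" if "y \<le> x" "z \<le> x"
      using that unfolding le_sup by (metis sup_assoc)
    show "bot \<le> x"
      unfolding le_sup by (metis sup_bot sup_comm)
    show "x \<le> top"
      unfolding less_eq_fba_def by (fact inf_top)
    show "sup x (inf y z) = inf (sup x y) (sup x z)" by (fact distrib)
    show "inf x (- x) = bot" by (fact inf_not)
    show "sup x (- x) = top" by (fact sup_not)
    show "x - y = inf x (- y)" by (fact minus_fba_def)
  qed
qed

end

primrec bexp_ext :: "('a \<Rightarrow> 'b :: boolean_algebra) \<Rightarrow> 'a bexp \<Rightarrow> 'b" where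
  "bexp_ext f (BGen x) = f x"
| "bexp_ext f BTop = top"
| "bexp_ext f BBot = bot"
| "bexp_ext f (BNot a) = - bexp_ext f a"
| "bexp_ext f (BAnd a b) = inf (bexp_ext f a) (bexp_ext f b)"
| "bexp_ext f (BOr a b) = sup (bexp_ext f a) (bexp_ext f b)"

text \<open>The homomorphic extension of a map on the generators; \<open>fba_ext_unique\<close> below states that
  it is the only one.\<close>

lift_definition fba_ext :: "('a \<Rightarrow> 'b :: boolean_algebra) \<Rightarrow> 'a fba \<Rightarrow> 'b" is bexp_ext
proof -
  fix f :: "'a \<Rightarrow> 'b" and a b :: "'a bexp"
  assume "beq a b"
  then show "bexp_ext f a = bexp_ext f b"
    by induction (simp_all add: ac_simps sup_inf_distrib1)
qed

lemma fba_ext_simps [simp]: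
  "fba_ext f (gen x) = f x"
  "fba_ext f top = top"
  "fba_ext f bot = bot"
  "fba_ext f (- a) = - fba_ext f a"
  "fba_ext f (inf a b) = inf (fba_ext f a) (fba_ext f b)"
  "fba_ext f (sup a b) = sup (fba_ext f a) (fba_ext f b)"
  by (transfer; simp)+

lemma fba_ext_unique:
  fixes F :: "'a fba \<Rightarrow> 'b :: boolean_algebra"
  assumes "\<And>x. F (gen x) = f x"
    and "F top = top" "F bot = bot" "\<And>a. F (- a) = - F a"
    and "\<And>a b. F (inf a b) = inf (F a) (F b)" "\<And>a b. F (sup a b) = sup (F a) (F b)"
  shows "F = fba_ext f"
proof
  fix p
  have "F (abs_fba e) = bexp_ext f e" for e
    using assms
    by (induction e)
      (simp_all flip: gen.abs_eq top_fba.abs_eq bot_fba.abs_eq uminus_fba.abs_eq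
        inf_fba.abs_eq sup_fba.abs_eq)
  then show "F p = fba_ext f p"
    by (induct p rule: fba.abs_induct) (simp add: fba_ext.abs_eq)
qed


section \<open>Values and super-truth\<close>

definition certified :: "tm \<Rightarrow> bool" where
  "certified t \<longleftrightarrow> (\<exists>u. t = All \<cdot> u \<and> {||} \<turnstile>\<^sub>O All \<cdot> Lam (isB (\<up> u \<cdot> Var 0)))"

lemma certified_example: "certified (All \<cdot> Lam (isN Zero))"
proof -
  let ?u = "Lam (isN Zero)"
  let ?\<Gamma> = "{|isN (Var 0)|}"
  have rga: "\<Gamma> \<turnstile>\<^sub>O c" if "rga_rule ps (\<Gamma> \<turnstile> c)" "\<And>p. p \<in> set ps \<Longrightarrow> derivable oga_rule p" for \<Gamma> c ps
    using derivable_rule[of oga_rule, OF oga_rule.rga] that by blast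
  have "?\<Gamma> \<turnstile>\<^sub>O isN Zero" by (rule rga[OF rga_rule.zero_isN]) simp
  moreover have "?u \<cdot> Var 0 \<triangleright> isN Zero" using head_step.beta[of "isN Zero" "Var 0"] by simp
  ultimately have "?\<Gamma> \<turnstile>\<^sub>O ?u \<cdot> Var 0"
    using rga[OF rga_rule.conv_expand] by fastforce
  then have "?\<Gamma> \<turnstile>\<^sub>O isB (?u \<cdot> Var 0)"
    using rga[OF rga_rule.or_I1] by fastforce
  moreover have "Lam (isB (?u \<cdot> Var 0)) \<cdot> Var 0 \<triangleright> isB (?u \<cdot> Var 0)"
    using head_step.beta[of "isB (?u \<cdot> Var 0)" "Var 0"] by simp
  ultimately have "?\<Gamma> \<turnstile>\<^sub>O Lam (isB (?u \<cdot> Var 0)) \<cdot> Var 0"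
    using rga[OF rga_rule.conv_expand] by fastforce
  then have "{||} \<turnstile>\<^sub>O All \<cdot> Lam (isB (?u \<cdot> Var 0))"
    by (intro rga[OF rga_rule.all_I]) simp
  then show ?thesis by (simp add: certified_def)
qed

text \<open>One atom \<open>atom_of t\<close> for each certified universal \<open>t\<close>; \<open>atom_of\<close> is unspecified on all other
  terms and is only used under the hypothesis \<open>certified t\<close>.\<close>

typedef atom = "{t. certified t}"
  morphisms univ_of atom_of
  using certified_example by blast

inductive has_value :: "tm \<Rightarrow> atom fba \<Rightarrow> bool"  (infix "\<leadsto>" 50) where
  provable: "{||} \<turnstile>\<^sub>O \<phi> \<Longrightarrow> \<phi> \<leadsto> top"
| refutable: "{||} \<turnstile>\<^sub>O \<^bold>\<not> \<phi> \<Longrightarrow> \<phi> \<leadsto> bot"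
| neg: "\<phi> \<leadsto> p \<Longrightarrow> \<^bold>\<not> \<phi> \<leadsto> - p"
| disj: "\<phi> \<leadsto> p \<Longrightarrow> \<psi> \<leadsto> q \<Longrightarrow> \<phi> \<^bold>\<or> \<psi> \<leadsto> sup p q"
| univ: "certified (All \<cdot> u) \<Longrightarrow> All \<cdot> u \<leadsto> gen (atom_of (All \<cdot> u))"

definition honest :: "(atom \<Rightarrow> bool) \<Rightarrow> tm fset \<Rightarrow> bool" where
  "honest w \<Delta> \<longleftrightarrow>
    (\<forall>t. t |\<in>| \<Delta> \<longrightarrow>
      (\<exists>u. certified (All \<cdot> u) \<and>
        (t = All \<cdot> u \<and> w (atom_of (All \<cdot> u)) \<or>
         t = \<^bold>\<not> (All \<cdot> u) \<and> \<not> w (atom_of (All \<cdot> u)))))"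

definition admissible :: "(atom \<Rightarrow> bool) \<Rightarrow> bool" where
  "admissible w \<longleftrightarrow> \<not> (\<exists>\<Delta> c. honest w \<Delta> \<and> \<Delta> \<turnstile>\<^sub>O c \<and> \<Delta> \<turnstile>\<^sub>O \<^bold>\<not> c)"

definition super_true :: "tm \<Rightarrow> bool" where
  "super_true \<phi> \<longleftrightarrow> (\<exists>p. \<phi> \<leadsto> p \<and> (\<forall>w. admissible w \<longrightarrow> fba_ext w p))"

end

theory Submission imports Defs begin

text \<open>
  An unprovable \<open>\<phi>\<close> is separated from the theorems by a Lindenbaum argument. Let \<open>S\<close> be a maximal set
  of terms no finite part of which derives \<open>\<phi>\<close>. The rule ATI makes every certified universal
  decidable, so \<open>S\<close> contains each certified universal or its negation, and reading off a valuation
  \<open>w\<close> from \<open>S\<close> puts all sets honest for \<open>w\<close> inside \<open>S\<close>. Such sets do not derive \<open>\<phi>\<close>; by explosion they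
  are consistent, so \<open>w\<close> is admissible. On the other hand a term with value \<open>p\<close> is derivable from an
  honest set if \<open>w(p)\<close> is true, and refutable from one otherwise. Hence \<open>w\<close> falsifies all values
  of \<open>\<phi>\<close>.
\<close>

lemma oga_by_rule:
  assumes "rga_rule ps j" and "\<And>p. p \<in> set ps \<Longrightarrow> derivable oga_rule p"
  shows "derivable oga_rule j"
  using derivable_rule[of oga_rule, OF oga_rule.rga] assms by blast

lemma oga_mono:
  assumes "\<Gamma> \<turnstile>\<^sub>O c" and "\<Gamma> |\<subseteq>| \<Delta>"
  shows "\<Delta> \<turnstile>\<^sub>O c"
proof -
  have "\<Theta> |\<union>| \<Gamma> \<turnstile>\<^sub>O c" for \<Theta>
    by (induction \<Theta>) (auto intro: assms(1) oga_by_rule[OF rga_rule.weaken])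
  from this[of \<Delta>] show ?thesis using assms(2) by (simp add: sup.absorb1)
qed

lemma oga_assm: "c |\<in>| \<Gamma> \<Longrightarrow> \<Gamma> \<turnstile>\<^sub>O c"
  using oga_by_rule[OF rga_rule.assm[of c \<Gamma>]] by (simp add: finsert_absorb)

lemma oga_explosion: "\<Gamma> \<turnstile>\<^sub>O a \<Longrightarrow> \<Gamma> \<turnstile>\<^sub>O \<^bold>\<not> a \<Longrightarrow> \<Gamma> \<turnstile>\<^sub>O c"
  by (rule oga_by_rule[OF rga_rule.explosion]) auto

text \<open>Being certified provides the premise of ATI in the empty context. This is the one place
  where ATI is applied; weakening then reaches any \<open>\<Gamma>\<close>.\<close>

lemma oga_certified_isB:
  assumes "certified t"
  shows "\<Gamma> \<turnstile>\<^sub>O isB t"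
proof -
  obtain u where "t = All \<cdot> u" "{||} \<turnstile>\<^sub>O All \<cdot> Lam (isB (\<up> u \<cdot> Var 0))"
    using assms by (auto simp: certified_def)
  then have "{||} \<turnstile>\<^sub>O isB t"
    using derivable_rule[of oga_rule, OF oga_rule.ati] by fastforce
  then show ?thesis by (rule oga_mono) simp
qed

text \<open>The calculus has no excluded middle for arbitrary terms, but certified universals obey
  it, so \<open>or_E\<close> allows a case split on them.\<close>

lemma oga_certified_cases:
  assumes "certified t" and "finsert t \<Gamma> \<turnstile>\<^sub>O c" and "finsert (\<^bold>\<not> t) \<Gamma> \<turnstile>\<^sub>O c"
  shows "\<Gamma> \<turnstile>\<^sub>O c"
  by (rule oga_by_rule[OF rga_rule.or_E[of \<Gamma> t "\<^bold>\<not> t" c]])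
    (use assms oga_certified_isB in auto)

lemma honest_union: "honest w \<Gamma> \<Longrightarrow> honest w \<Delta> \<Longrightarrow> honest w (\<Gamma> |\<union>| \<Delta>)"
  by (auto simp: honest_def)

text \<open>Evaluation mirrors derivability: each clause for values has a matching rule, once the
  literals true under \<open>w\<close> serve as hypotheses. Both polarities are carried along so
  that the induction passes through negation.\<close>

lemma has_value_honest:
  assumes "\<phi> \<leadsto> p"
  shows "\<exists>\<Delta>. honest w \<Delta> \<and> (\<Delta> \<turnstile>\<^sub>O (if fba_ext w p then \<phi> else \<^bold>\<not> \<phi>))"
  using assms
proof induction
  case (provable \<phi>)
  then show ?case by (intro exI[of _ "{||}"]) (simp add: honest_def)
next
  case (refutable \<phi>)
  then show ?case by (intro exI[of _ "{||}"]) (simp add: honest_def)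
next
  case (neg \<phi> p)
  then obtain \<Delta> where "honest w \<Delta>" "\<Delta> \<turnstile>\<^sub>O (if fba_ext w p then \<phi> else \<^bold>\<not> \<phi>)" by blast
  \<comment> \<open>If \<open>w\<close> makes \<open>p\<close> true, a double negation is due; if
    false, the derived negation is already the goal.\<close>
  then show ?case
    by (intro exI[of _ \<Delta>]) (auto intro: oga_by_rule[OF rga_rule.notnot_I])
next
  case (disj \<phi> p \<psi> q)
  then obtain \<Gamma> \<Delta> where honest: "honest w \<Gamma>" "honest w \<Delta>"
    and "\<Gamma> \<turnstile>\<^sub>O (if fba_ext w p then \<phi> else \<^bold>\<not> \<phi>)" "\<Delta> \<turnstile>\<^sub>O (if fba_ext w q then \<psi> else \<^bold>\<not> \<psi>)"
    by blast
  then have "\<Gamma> |\<union>| \<Delta> \<turnstile>\<^sub>O (if fba_ext w p then \<phi> else \<^bold>\<not> \<phi>)"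
    "\<Gamma> |\<union>| \<Delta> \<turnstile>\<^sub>O (if fba_ext w q then \<psi> else \<^bold>\<not> \<psi>)"
    by (blast intro: oga_mono)+
  then have "\<Gamma> |\<union>| \<Delta> \<turnstile>\<^sub>O (if fba_ext w (sup p q) then \<phi> \<^bold>\<or> \<psi> else \<^bold>\<not> (\<phi> \<^bold>\<or> \<psi>))"
    by (cases "fba_ext w p"; cases "fba_ext w q")
      (auto intro: oga_by_rule[OF rga_rule.or_I1] oga_by_rule[OF rga_rule.or_I2]
        oga_by_rule[OF rga_rule.not_or_I])
  then show ?case using honest honest_union by blast
next
  case (univ u)
  let ?t = "All \<cdot> u"
  let ?l = "if w (atom_of ?t) then ?t else \<^bold>\<not> ?t"
  have "honest w {|?l|}" using univ by (auto simp: honest_def)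
  moreover have "{|?l|} \<turnstile>\<^sub>O ?l" by (rule oga_assm) simp
  ultimately show ?case by (intro exI[of _ "{|?l|}"]) simp
qed

text \<open>Contexts are finite, so a possibly infinite \<open>S\<close> enters only through its
  finite parts. This makes the property pass to unions of chains.\<close>

definition avoids :: "tm \<Rightarrow> tm set \<Rightarrow> bool" where
  "avoids \<phi> S \<longleftrightarrow> (\<forall>\<Delta>. fset \<Delta> \<subseteq> S \<longrightarrow> \<not> (\<Delta> \<turnstile>\<^sub>O \<phi>))"

lemma avoids_Union_chain:
  assumes "C \<noteq> {}" and chain: "subset.chain {S. avoids \<phi> S} C"
  shows "avoids \<phi> (\<Union>C)"
  unfolding avoids_def
proof (intro allI impI)
  fix \<Delta> assume "fset \<Delta> \<subseteq> \<Union>C"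
  then obtain S where "S \<in> C" "fset \<Delta> \<subseteq> S"
    using finite_subset_Union_chain[OF finite_fset _ assms] by blast
  then show "\<not> (\<Delta> \<turnstile>\<^sub>O \<phi>)"
    using chain unfolding subset.chain_def avoids_def by blast
qed

lemma maximal_avoids_exists:
  assumes "\<not> ({||} \<turnstile>\<^sub>O \<phi>)"
  obtains S where "avoids \<phi> S" "\<And>T. avoids \<phi> T \<Longrightarrow> S \<subseteq> T \<Longrightarrow> T = S"
proof -
  \<comment> \<open>The only finite part of the empty set is \<open>{||}\<close>. This gives Zorn's
    lemma its nonempty family.\<close>
  have "avoids \<phi> {}"
    using assms by (simp add: avoids_def fset_inject[of _ "{||}", simplified])
  then have "\<exists>M\<in>{S. avoids \<phi> S}. \<forall>X\<in>{S. avoids \<phi> S}. M \<subseteq> X \<longrightarrow> X = M"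
    by (intro subset_Zorn_nonempty) (use avoids_Union_chain in auto)
  then show ?thesis using that by auto
qed

lemma not_avoids_insert:
  assumes "\<not> avoids \<phi> (insert t S)"
  obtains \<Delta> where "fset \<Delta> \<subseteq> S" "finsert t \<Delta> \<turnstile>\<^sub>O \<phi>"
proof -
  obtain \<Gamma> where \<Gamma>: "fset \<Gamma> \<subseteq> insert t S" "\<Gamma> \<turnstile>\<^sub>O \<phi>"
    using assms by (auto simp: avoids_def)
  show ?thesis
  proof (rule that)
    show "fset (\<Gamma> |-| {|t|}) \<subseteq> S" using \<Gamma>(1) by auto
    show "finsert t (\<Gamma> |-| {|t|}) \<turnstile>\<^sub>O \<phi>" using \<Gamma>(2) by (rule oga_mono) auto
  qed
qed

text \<open>If both were missing, adding either one would make \<open>\<phi>\<close> derivable.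
  Pooling the two finite contexts and splitting on \<open>t\<close> would then derive
  \<open>\<phi>\<close> from \<open>S\<close> alone.\<close>

lemma maximal_avoids_decides:
  assumes avoids: "avoids \<phi> S" and max: "\<And>T. avoids \<phi> T \<Longrightarrow> S \<subseteq> T \<Longrightarrow> T = S"
    and t: "certified t"
  shows "t \<in> S \<or> \<^bold>\<not> t \<in> S"
proof (rule ccontr)
  assume "\<not> (t \<in> S \<or> \<^bold>\<not> t \<in> S)"
  then have "\<not> avoids \<phi> (insert t S)" "\<not> avoids \<phi> (insert (\<^bold>\<not> t) S)"
    using max by blast+
  then obtain \<Gamma> \<Delta> where sub: "fset \<Gamma> \<subseteq> S" "fset \<Delta> \<subseteq> S"
    and "finsert t \<Gamma> \<turnstile>\<^sub>O \<phi>" "finsert (\<^bold>\<not> t) \<Delta> \<turnstile>\<^sub>O \<phi>"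
    by (metis not_avoids_insert)
  then have "finsert t (\<Gamma> |\<union>| \<Delta>) \<turnstile>\<^sub>O \<phi>" "finsert (\<^bold>\<not> t) (\<Gamma> |\<union>| \<Delta>) \<turnstile>\<^sub>O \<phi>"
    by (blast intro: oga_mono)+
  then have "\<Gamma> |\<union>| \<Delta> \<turnstile>\<^sub>O \<phi>" by (rule oga_certified_cases[OF t])
  then show False using avoids sub by (auto simp: avoids_def)
qed

lemma separating_valuation_exists:
  assumes "\<not> ({||} \<turnstile>\<^sub>O \<phi>)"
  obtains w where "\<And>\<Delta>. honest w \<Delta> \<Longrightarrow> \<not> (\<Delta> \<turnstile>\<^sub>O \<phi>)"
proof -
  obtain S where S: "avoids \<phi> S" "\<And>T. avoids \<phi> T \<Longrightarrow> S \<subseteq> T \<Longrightarrow> T = S"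
    using maximal_avoids_exists[OF assms] by blast
  define w where "w a \<longleftrightarrow> univ_of a \<in> S" for a
  have w: "w (atom_of t) \<longleftrightarrow> t \<in> S" if "certified t" for t
    using that by (simp add: w_def atom_of_inverse)
  \<comment> \<open>A negative literal of an honest set has its universal outside \<open>S\<close>,
    so its negation lies in \<open>S\<close> because \<open>S\<close> decides it.\<close>
  have "fset \<Delta> \<subseteq> S" if "honest w \<Delta>" for \<Delta>
    using that w maximal_avoids_decides[OF S] unfolding honest_def by blast
  then show ?thesis using that S(1) unfolding avoids_def by blast
qed

theorem theorem4p2:
  fixes \<phi> :: tm
  shows "{||} \<turnstile>\<^sub>O \<phi> \<longleftrightarrow> super_true \<phi>"
proof
  assume "{||} \<turnstile>\<^sub>O \<phi>"
  then have "\<phi> \<leadsto> top" by (rule has_value.provable)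
  then show "super_true \<phi>" unfolding super_true_def by (intro exI[of _ top]) simp
next
  assume "super_true \<phi>"
  then obtain p where p: "\<phi> \<leadsto> p" "\<And>w. admissible w \<Longrightarrow> fba_ext w p"
    by (auto simp: super_true_def)
  show "{||} \<turnstile>\<^sub>O \<phi>"
  proof (rule ccontr)
    assume "\<not> ({||} \<turnstile>\<^sub>O \<phi>)"
    then obtain w where w: "\<And>\<Delta>. honest w \<Delta> \<Longrightarrow> \<not> (\<Delta> \<turnstile>\<^sub>O \<phi>)"
      using separating_valuation_exists by blast
    then have "admissible w"
      using oga_explosion unfolding admissible_def by blast
    then have "fba_ext w p" by (rule p(2))
    \<comment> \<open>As \<open>w\<close> makes \<open>p\<close> true, the evaluation gives an
      honest set that derives \<open>\<phi>\<close> itself.\<close>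
    then show False using has_value_honest[OF p(1), of w] w by auto
  qed
qed

end
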